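(* Let $\mathcal{T}_1$ and $\mathcal{T}_2$ be two non-isomorphic trees on the same number of vertices. Then $\mathcal{T}_1$ and $\mathcal{T}_2$ are co-Kemeny mates if and only if $W(\mathcal{T}_1)=W(\mathcal{T}_2)$.
   Context: Graphs are finite, simple and undirected. Let $G$ be a connected graph with vertex set $\{1,\dots,n\}$, $n\ge2$. Let $m_G$ be its number of edges, $\tau_G$ its number of spanning trees, and $\mathbf{d}_G$ the column vector whose $i$-th entry is the degree of vertex $i$. A 2-tree spanning forest of $G$ is a spanning subgraph that is a forest with exactly two connected components (trees). Let $f^G_{i,j}$ be the number of 2-tree spanning forests of $G$ in which one of the two trees contains $i$ and the other contains $j$ (so $f^G_{i,i}=0$), and let $F_G=[f^G_{i,j}]_{i,j=1}^n$. Kemeny's constant of (the random walk on) $G$ is $$\kappa(G)=\frac{\mathbf{d}_G^TF_G\mathbf{d}_G}{4m_G\tau_G}.$$ Two non-isomorphic connected graphs $G_1,G_2$ on the same number of vertices are called co-Kemeny mates if $\kappa(G_1)=\kappa(G_2)$. The Wiener index of $G$ is $W(G)=\frac12\mathbf{1}^TD\mathbf{1}$, where $D=[\mathrm{dist}_G(i,j)]_{i,j=1}^n$ is the distance matrix and $\mathbf{1}$ is the all-ones vector; that is, $W(G)$ is the sum of the distances over all unordered pairs of vertices. *)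

theory Defs
  imports Complex_Main
begin

text \<open>
  Undirected graphs are given by a vertex set and a set of edges, an edge being the set of its
  two endpoints. Record equality then makes the subgraphs of a graph countable with \<^const>\<open>card\<close>.
\<close>

record 'v graph =
  verts :: "'v set"
  edges :: "'v set set"

definition simple_graph :: "'v graph \<Rightarrow> bool" where
  "simple_graph G \<longleftrightarrow>
     finite (verts G) \<and> (\<forall>e\<in>edges G. e \<subseteq> verts G \<and> card e = 2)"

text \<open>Walks are nonempty lists of vertices; a walk of length \<open>k\<close> visits \<open>k + 1\<close> vertices.\<close>

definition walk :: "'v graph \<Rightarrow> 'v \<Rightarrow> 'v list \<Rightarrow> 'v \<Rightarrow> bool" where
  "walk G u p v \<longleftrightarrow>
     p \<noteq> [] \<and> hd p = u \<and> last p = v \<and> set p \<subseteq> verts G \<and>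
     (\<forall>i. Suc i < length p \<longrightarrow> {p ! i, p ! Suc i} \<in> edges G)"

definition reachable :: "'v graph \<Rightarrow> 'v \<Rightarrow> 'v \<Rightarrow> bool" where
  "reachable G u v \<longleftrightarrow> (\<exists>p. walk G u p v)"

definition connected_graph :: "'v graph \<Rightarrow> bool" where
  "connected_graph G \<longleftrightarrow>
     simple_graph G \<and> verts G \<noteq> {} \<and> (\<forall>u\<in>verts G. \<forall>v\<in>verts G. reachable G u v)"

text \<open>Each component is represented by its vertex set.\<close>

definition components :: "'v graph \<Rightarrow> 'v set set" where
  "components G = (\<lambda>u. {v \<in> verts G. reachable G u v}) ` verts G"

text \<open>
  A cycle is listed without repeating its first vertex at the end, hence the index modulo the
  length. The bound 3 excludes going back and forth along one edge.
\<close>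

definition is_cycle :: "'v graph \<Rightarrow> 'v list \<Rightarrow> bool" where
  "is_cycle G p \<longleftrightarrow>
     3 \<le> length p \<and> distinct p \<and>
     (\<forall>i<length p. {p ! i, p ! (Suc i mod length p)} \<in> edges G)"

definition forest :: "'v graph \<Rightarrow> bool" where
  "forest G \<longleftrightarrow> simple_graph G \<and> (\<nexists>p. is_cycle G p)"

definition tree :: "'v graph \<Rightarrow> bool" where
  "tree G \<longleftrightarrow> connected_graph G \<and> forest G"

definition isomorphic :: "'v graph \<Rightarrow> 'w graph \<Rightarrow> bool" where
  "isomorphic G H \<longleftrightarrow>
     (\<exists>f. bij_betw f (verts G) (verts H) \<and>
          (\<forall>u\<in>verts G. \<forall>v\<in>verts G. {u, v} \<in> edges G \<longleftrightarrow> {f u, f v} \<in> edges H))"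

definition spanning_subgraph :: "'v graph \<Rightarrow> 'v graph \<Rightarrow> bool" where
  "spanning_subgraph H G \<longleftrightarrow> verts H = verts G \<and> edges H \<subseteq> edges G"

definition num_edges :: "'v graph \<Rightarrow> nat" where
  "num_edges G = card (edges G)"

definition degree :: "'v graph \<Rightarrow> 'v \<Rightarrow> nat" where
  "degree G v = card {e \<in> edges G. v \<in> e}"

definition num_spanning_trees :: "'v graph \<Rightarrow> nat" where
  "num_spanning_trees G = card {H. spanning_subgraph H G \<and> tree H}"

definition two_tree_spanning_forest :: "'v graph \<Rightarrow> 'v graph \<Rightarrow> bool" where
  "two_tree_spanning_forest H G \<longleftrightarrow>
     spanning_subgraph H G \<and> forest H \<and> card (components H) = 2"

text \<open>\<open>forest_count G i j\<close> is the \<open>(i,j)\<close> entry of the matrix \<open>F\<close>.\<close>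

definition forest_count :: "'v graph \<Rightarrow> 'v \<Rightarrow> 'v \<Rightarrow> nat" where
  "forest_count G i j =
     card {H. two_tree_spanning_forest H G \<and>
              (\<exists>A\<in>components H. \<exists>B\<in>components H. A \<noteq> B \<and> i \<in> A \<and> j \<in> B)}"

text \<open>The numerator is the quadratic form \<open>d\<^sup>T F d\<close> of the degree vector \<open>d\<close>, written out.\<close>

definition kemeny :: "'v graph \<Rightarrow> real" where
  "kemeny G =
     (\<Sum>i\<in>verts G. \<Sum>j\<in>verts G.
        real (degree G i) * real (forest_count G i j) * real (degree G j))
     / (4 * real (num_edges G) * real (num_spanning_trees G))"

definition co_Kemeny_mates :: "'v graph \<Rightarrow> 'w graph \<Rightarrow> bool" where
  "co_Kemeny_mates G H \<longleftrightarrow>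
     connected_graph G \<and> connected_graph H \<and> card (verts G) = card (verts H) \<and>
     \<not> isomorphic G H \<and> kemeny G = kemeny H"

text \<open>Only meaningful if \<open>v\<close> is reachable from \<open>u\<close>, in particular in connected graphs.\<close>

definition graph_dist :: "'v graph \<Rightarrow> 'v \<Rightarrow> 'v \<Rightarrow> nat" where
  "graph_dist G u v = (LEAST k. \<exists>p. walk G u p v \<and> length p = Suc k)"

definition wiener_index :: "'v graph \<Rightarrow> real" where
  "wiener_index G = (\<Sum>i\<in>verts G. \<Sum>j\<in>verts G. real (graph_dist G i j)) / 2"

end

theory Submission
  imports Defs
begin

text \<open>
  In a tree every edge is a bridge, so the tree is its own only spanning tree, its 2-tree spanning
  forests are obtained by deleting one edge, and \<open>F\<close> is the distance matrix \<open>D\<close>. Fix a root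
  \<open>i\<close>. Each vertex \<open>j \<noteq> i\<close> has a unique edge towards \<open>i\<close>, these are all the edges, and the
  distances of the two ends of such an edge to \<open>i\<close> add up to \<open>2 dist(i,j) - 1\<close>. Hence
  \<open>D d = 2 D 1 - (n - 1) 1\<close>, which gives
  \<open>d\<^sup>T D d = 8 W - 2 (n - 1) (2 n - 1)\<close>, and \<open>\<kappa>\<close> is an increasing affine function of \<open>W\<close> that
  depends only on \<open>n\<close>.
\<close>

section \<open>Edge relation, edge deletion and walks\<close>

text \<open>Reachability becomes the closure \<open>(adj G)\<^sup>*\<close>, which comes with
  induction rules, transitivity and monotonicity.\<close>

definition adj :: "'v graph \<Rightarrow> ('v \<times> 'v) set" where
  "adj G = {(u, v). {u, v} \<in> edges G}"

definition del_edge :: "'v graph \<Rightarrow> 'v set \<Rightarrow> 'v graph" where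
  "del_edge G e = G\<lparr>edges := edges G - {e}\<rparr>"

lemma verts_del_edge [simp]: "verts (del_edge G e) = verts G"
  and edges_del_edge [simp]: "edges (del_edge G e) = edges G - {e}"
  by (simp_all add: del_edge_def)

lemma simple_graph_del_edge: "simple_graph G \<Longrightarrow> simple_graph (del_edge G e)"
  by (auto simp: simple_graph_def)

lemma simple_graph_finite_verts: "simple_graph G \<Longrightarrow> finite (verts G)"
  by (simp add: simple_graph_def)

lemma simple_graph_finite_edges:
  assumes "simple_graph G"
  shows "finite (edges G)"
  using assms finite_subset[of "edges G" "Pow (verts G)"] by (auto simp: simple_graph_def)

lemma simple_graph_edgeD:
  assumes "simple_graph G" "{u, v} \<in> edges G"
  shows "u \<in> verts G" "v \<in> verts G" "u \<noteq> v"
  using assms by (auto simp: simple_graph_def)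

lemma simple_graph_edgeE:
  assumes "simple_graph G" "e \<in> edges G"
  obtains u v where "e = {u, v}" "u \<noteq> v"
  using assms by (metis card_2_iff simple_graph_def)

lemma walk_iff_successively:
  "walk G u p v \<longleftrightarrow> p \<noteq> [] \<and> hd p = u \<and> last p = v \<and> set p \<subseteq> verts G \<and>
     successively (\<lambda>x y. {x, y} \<in> edges G) p"
  by (auto simp: walk_def successively_conv_nth)

lemma walk_refl: "u \<in> verts G \<Longrightarrow> walk G u [u] u"
  by (simp add: walk_iff_successively)

lemma walk_snoc:
  assumes "walk G u p v" "{v, w} \<in> edges G" "w \<in> verts G"
  shows "walk G u (p @ [w]) w"
  using assms by (auto simp: walk_iff_successively successively_append_iff)

lemma walk_snocD:
  assumes "walk G u (p @ [w]) v" "p \<noteq> []"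
  shows "v = w" "walk G u p (last p)" "{last p, w} \<in> edges G"
  using assms by (auto simp: walk_iff_successively successively_append_iff)

text \<open>Distinctness is what turns such a walk into a cycle later on. When the next vertex has
  already been visited, the walk is cut at that visit instead of being prolonged.\<close>

lemma adj_rtrancl_distinct_walk:
  assumes "simple_graph G" "u \<in> verts G" "(u, v) \<in> (adj G)\<^sup>*"
  shows "\<exists>p. walk G u p v \<and> distinct p"
  using assms(3)
proof (induction rule: rtrancl_induct)
  case base
  then show ?case using walk_refl[OF assms(2)] by force
next
  case (step v w)
  then obtain p where p: "walk G u p v" "distinct p" by blast
  have e: "{v, w} \<in> edges G" using step by (simp add: adj_def)
  show ?case
  proof (cases "w \<in> set p")
    case True
    then obtain xs ys where "p = xs @ w # ys" by (meson split_list)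
    then have "walk G u (xs @ [w]) w" "distinct (xs @ [w])"
      using p by (auto simp: walk_iff_successively successively_append_iff hd_append
          split: if_splits)
    then show ?thesis by blast
  next
    case False
    then show ?thesis
      using walk_snoc[OF p(1) e] simple_graph_edgeD[OF assms(1) e] p(2) by auto
  qed
qed

lemma walk_imp_adj_rtrancl: "walk G u p v \<Longrightarrow> (u, v) \<in> (adj G)\<^sup>*"
proof (induction p arbitrary: v rule: rev_induct)
  case (snoc w p)
  show ?case
  proof (cases "p = []")
    case True
    then show ?thesis using snoc.prems by (auto simp: walk_def)
  next
    case False
    note walk_snocD[OF snoc.prems False]
    then show ?thesis using snoc.IH by (auto simp: adj_def intro: rtrancl_into_rtrancl)
  qed
qed (simp add: walk_def)

text \<open>The condition on \<open>u\<close> rules out the reflexive pairs of the closure outside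
  the graph: walks stay in \<open>verts G\<close>.\<close>

lemma reachable_iff_adj:
  assumes "simple_graph G" "u \<in> verts G"
  shows "reachable G u v \<longleftrightarrow> (u, v) \<in> (adj G)\<^sup>*"
  unfolding reachable_def using adj_rtrancl_distinct_walk[OF assms] walk_imp_adj_rtrancl by metis

lemma adj_rtrancl_sym: "(u, v) \<in> (adj G)\<^sup>* \<Longrightarrow> (v, u) \<in> (adj G)\<^sup>*"
  by (rule symD[OF sym_rtrancl]) (auto simp: sym_def adj_def insert_commute)

lemma adj_rtrancl_mono:
  assumes "edges H \<subseteq> edges G" "(u, v) \<in> (adj H)\<^sup>*"
  shows "(u, v) \<in> (adj G)\<^sup>*"
  using assms rtrancl_mono[of "adj H" "adj G"] by (auto simp: adj_def)

section \<open>Bridges and the unique spanning tree\<close>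

text \<open>A distinct walk around a non-bridge closes up to a cycle.\<close>

lemma forest_bridge:
  assumes "forest G" "{u, v} \<in> edges G"
  shows "(u, v) \<notin> (adj (del_edge G {u, v}))\<^sup>*"
proof
  let ?H = "del_edge G {u, v}"
  assume r: "(u, v) \<in> (adj ?H)\<^sup>*"
  have sg: "simple_graph G" using assms by (simp add: forest_def)
  note uv = simple_graph_edgeD[OF sg assms(2)]
  obtain p where p: "walk ?H u p v" "distinct p"
    using adj_rtrancl_distinct_walk[OF simple_graph_del_edge[OF sg] _ r] uv
    by (metis verts_del_edge)
  have ne: "p \<noteq> []" "p ! 0 = u" "p ! (length p - 1) = v"
    and st: "\<And>i. Suc i < length p \<Longrightarrow> {p ! i, p ! Suc i} \<in> edges ?H"
    using p by (auto simp: walk_def hd_conv_nth last_conv_nth)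
  \<comment> \<open>A walk with one vertex would give \<open>u = v\<close>, and one with two
    vertices would use the deleted edge itself.\<close>
  have "length p \<noteq> 0" "length p \<noteq> 1" using ne uv by auto
  moreover have "length p \<noteq> 2"
    using st[of 0] ne by auto
  ultimately have len: "3 \<le> length p" by linarith
  have "{p ! i, p ! (Suc i mod length p)} \<in> edges G" if "i < length p" for i
  proof (cases "Suc i < length p")
    case True
    then show ?thesis using st[OF True] by simp
  next
    \<comment> \<open>At the last index the successor wraps around to 0, and the closing edge is the
      deleted one.\<close>
    case False
    then have i: "i = length p - 1" "Suc i = length p" using that by auto
    then show ?thesis using ne assms(2) by (simp add: insert_commute)
  qed
  then have "is_cycle G p" using len p by (simp add: is_cycle_def)
  then show False using assms by (auto simp: forest_def)
qed

lemma forest_spanning_subgraph: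
  assumes "spanning_subgraph H G" "forest G"
  shows "forest H"
  using assms unfolding forest_def spanning_subgraph_def simple_graph_def is_cycle_def
  by (metis subsetD)

lemma treeD:
  assumes "tree G"
  shows "simple_graph G" "forest G" "verts G \<noteq> {}" "connected_graph G"
  using assms by (auto simp: tree_def connected_graph_def)

lemma tree_adj_rtrancl:
  assumes "tree G" "u \<in> verts G" "v \<in> verts G"
  shows "(u, v) \<in> (adj G)\<^sup>*"
  using assms reachable_iff_adj[of G u v] by (auto simp: tree_def connected_graph_def)

text \<open>An edge outside \<open>E\<close> would be a bridge, so \<open>E\<close> could not
  connect its ends. This minimality serves twice: for the uniqueness of the spanning tree, and to
  show that the edges towards a root are all the edges.\<close>

lemma tree_spanning_connected_edges_eq:
  assumes "tree G" "E \<subseteq> edges G"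
    and conn: "\<And>u v. u \<in> verts G \<Longrightarrow> v \<in> verts G \<Longrightarrow> (u, v) \<in> {(x, y). {x, y} \<in> E}\<^sup>*"
  shows "E = edges G"
proof (rule ccontr)
  assume "E \<noteq> edges G"
  then obtain e where e: "e \<in> edges G" "e \<notin> E" using assms by auto
  obtain u v where uv: "e = {u, v}" using simple_graph_edgeE e treeD[OF assms(1)] by metis
  have "u \<in> verts G" "v \<in> verts G"
    using simple_graph_edgeD[OF treeD(1)[OF assms(1)]] e uv by auto
  then have "(u, v) \<in> {(x, y). {x, y} \<in> E}\<^sup>*" using conn by blast
  moreover have "{(x, y). {x, y} \<in> E} \<subseteq> adj (del_edge G e)"
    using e assms by (auto simp: adj_def)
  ultimately have "(u, v) \<in> (adj (del_edge G {u, v}))\<^sup>*"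
    using rtrancl_mono uv by blast
  then show False using forest_bridge[OF treeD(2)[OF assms(1)]] e uv by blast
qed

lemma num_spanning_trees_tree:
  assumes "tree G"
  shows "num_spanning_trees G = 1"
proof -
  have "H = G" if "spanning_subgraph H G" "tree H" for H
  proof -
    have "edges H = edges G"
      using tree_spanning_connected_edges_eq[OF assms, of "edges H"] that tree_adj_rtrancl[of H]
      by (auto simp: spanning_subgraph_def adj_def)
    then show ?thesis using that by (intro graph.equality) (auto simp: spanning_subgraph_def)
  qed
  then have "{H. spanning_subgraph H G \<and> tree H} = {G}"
    using assms by (auto simp: spanning_subgraph_def)
  then show ?thesis by (simp add: num_spanning_trees_def)
qed

text \<open>Follow the connection from \<open>a\<close> to \<open>v\<close> in \<open>G\<close>: a
  step along the deleted edge ends in \<open>a\<close> or \<open>b\<close>, where the connection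
  restarts trivially; any other step survives the deletion.\<close>

lemma tree_del_edge_cases:
  assumes "tree G" "{a, b} \<in> edges G" "v \<in> verts G"
  shows "(a, v) \<in> (adj (del_edge G {a, b}))\<^sup>* \<or> (b, v) \<in> (adj (del_edge G {a, b}))\<^sup>*"
proof -
  have "a \<in> verts G" using assms simple_graph_edgeD treeD by metis
  then have "(a, v) \<in> (adj G)\<^sup>*" using assms tree_adj_rtrancl by metis
  then show ?thesis
  proof (induction rule: rtrancl_induct)
    case (step v w)
    show ?case
    proof (cases "{v, w} = {a, b}")
      case True
      then show ?thesis by (auto simp: doubleton_eq_iff)
    next
      case False
      then have "(v, w) \<in> adj (del_edge G {a, b})" using step by (auto simp: adj_def)
      then show ?thesis using step by (meson rtrancl.rtrancl_into_rtrancl)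
    qed
  qed auto
qed

section \<open>Components and 2-tree spanning forests of a tree\<close>

definition component_of :: "'v graph \<Rightarrow> 'v \<Rightarrow> 'v set" where
  "component_of G u = {v \<in> verts G. reachable G u v}"

lemma components_eq: "components G = component_of G ` verts G"
  by (simp add: components_def component_of_def)

lemma component_of_eq_iff:
  assumes "simple_graph G" "u \<in> verts G" "v \<in> verts G"
  shows "component_of G u = component_of G v \<longleftrightarrow> (u, v) \<in> (adj G)\<^sup>*"
  using assms reachable_iff_adj[of G]
  by (auto simp: component_of_def intro: rtrancl_trans adj_rtrancl_sym)

text \<open>Turns the condition in \<open>forest_count\<close> into one about the edge relation. A
  component containing \<open>i\<close> is the component of \<open>i\<close>.\<close>

lemma in_different_components_iff:
  assumes "simple_graph G" "i \<in> verts G" "j \<in> verts G"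
  shows "(\<exists>A\<in>components G. \<exists>B\<in>components G. A \<noteq> B \<and> i \<in> A \<and> j \<in> B) \<longleftrightarrow> (i, j) \<notin> (adj G)\<^sup>*"
    (is "?L \<longleftrightarrow> ?R")
proof
  assume ?L
  then obtain a b where ab: "a \<in> verts G" "b \<in> verts G" "component_of G a \<noteq> component_of G b"
    "i \<in> component_of G a" "j \<in> component_of G b"
    unfolding components_eq by blast
  then have "component_of G a = component_of G i" "component_of G b = component_of G j"
    using assms component_of_eq_iff[OF assms(1)] reachable_iff_adj[OF assms(1)]
    by (metis (no_types, lifting) component_of_def mem_Collect_eq)+
  then show ?R using ab assms component_of_eq_iff by metis
next
  assume ?R
  then have "component_of G i \<noteq> component_of G j" using assms component_of_eq_iff by metis
  moreover have "i \<in> component_of G i" "j \<in> component_of G j"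
    using assms by (auto simp: component_of_def reachable_iff_adj)
  ultimately show ?L using assms unfolding components_eq by blast
qed

lemma components_del_edge:
  assumes "tree G" "{a, b} \<in> edges G"
  shows "components (del_edge G {a, b}) =
    {component_of (del_edge G {a, b}) a, component_of (del_edge G {a, b}) b}"
proof -
  let ?H = "del_edge G {a, b}"
  have sg: "simple_graph ?H" using simple_graph_del_edge treeD assms by metis
  have ab: "a \<in> verts G" "b \<in> verts G" using simple_graph_edgeD assms treeD by metis+
  have "component_of ?H v = component_of ?H a \<or> component_of ?H v = component_of ?H b"
    if "v \<in> verts G" for v
    using tree_del_edge_cases[OF assms that] component_of_eq_iff[OF sg] ab that
    by (metis verts_del_edge)
  then show ?thesis using ab by (auto simp: components_eq)
qed

lemma card_components_del_edge:
  assumes "tree G" "{a, b} \<in> edges G"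
  shows "card (components (del_edge G {a, b})) = 2"
proof -
  have "a \<in> verts G" "b \<in> verts G" using simple_graph_edgeD assms treeD by metis+
  then have "component_of (del_edge G {a, b}) a \<noteq> component_of (del_edge G {a, b}) b"
    using forest_bridge[OF treeD(2)[OF assms(1)] assms(2)]
      component_of_eq_iff[OF simple_graph_del_edge[OF treeD(1)[OF assms(1)]]]
    by (metis verts_del_edge)
  then show ?thesis by (simp add: components_del_edge[OF assms])
qed

text \<open>If two edges are missing, the ends of one of them and the far end of the other are
  pairwise disconnected.\<close>

lemma spanning_subgraph_two_missing:
  assumes "tree G" "spanning_subgraph H G"
    and e: "e \<in> edges G" "e \<notin> edges H" and f: "f \<in> edges G" "f \<notin> edges H" and "e \<noteq> f"
  shows "card (components H) \<noteq> 2"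
proof -
  note G = treeD[OF assms(1)]
  have sg: "simple_graph H"
    using assms G by (auto simp: spanning_subgraph_def simple_graph_def)
  have V: "verts H = verts G" using assms by (simp add: spanning_subgraph_def)
  have He: "edges H \<subseteq> edges (del_edge G e)" and Hf: "edges H \<subseteq> edges (del_edge G f)"
    using assms by (auto simp: spanning_subgraph_def)
  obtain c d where cd: "f = {c, d}" using simple_graph_edgeE[OF G(1) f(1)] by metis
  have cdG: "c \<in> verts G" "d \<in> verts G" using simple_graph_edgeD G f cd by metis+
  \<comment> \<open>The ends of \<open>e\<close> are named so that \<open>a\<close> lies on the side
    of \<open>c\<close> once \<open>e\<close> is deleted.\<close>
  obtain a b where ab: "e = {a, b}" "(a, c) \<in> (adj (del_edge G e))\<^sup>*"
  proof -
    obtain a b where ab: "e = {a, b}" using simple_graph_edgeE[OF G(1) e(1)] by metis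
    from tree_del_edge_cases[OF assms(1) e(1)[unfolded ab] cdG(1)]
    show thesis using that[of a b] that[of b a] ab by (auto simp: insert_commute)
  qed
  have abG: "a \<in> verts G" "b \<in> verts G" using simple_graph_edgeD G e ab by metis+
  \<comment> \<open>The edge \<open>f\<close> survives the deletion of \<open>e\<close>, so
    \<open>d\<close> lies on the side of \<open>a\<close> too, and \<open>b\<close> is cut off from
    both ends of \<open>f\<close>.\<close>
  have "(c, d) \<in> adj (del_edge G e)" using f cd assms by (simp add: adj_def)
  then have ad: "(a, d) \<in> (adj (del_edge G e))\<^sup>*" using ab by auto
  have nab: "(a, b) \<notin> (adj (del_edge G e))\<^sup>*" using forest_bridge G e ab by metis
  have "(c, d) \<notin> (adj H)\<^sup>*"
    using forest_bridge[OF G(2) f(1)[unfolded cd]] adj_rtrancl_mono[OF Hf] cd by metis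
  moreover have "(c, b) \<notin> (adj H)\<^sup>*" "(d, b) \<notin> (adj H)\<^sup>*"
    using nab ab ad adj_rtrancl_mono[OF He] by (meson rtrancl_trans)+
  ultimately have "card {component_of H c, component_of H d, component_of H b} = 3"
    using component_of_eq_iff[OF sg] cdG abG V by simp
  moreover have "card {component_of H c, component_of H d, component_of H b} \<le> card (components H)"
    using cdG abG V simple_graph_finite_verts[OF sg]
    by (intro card_mono) (auto simp: components_eq)
  ultimately show ?thesis by linarith
qed

text \<open>The number of missing edges decides: none leaves one component, one leaves two, and
  several never leave exactly two.\<close>

lemma two_tree_spanning_forest_tree_iff:
  assumes "tree G"
  shows "two_tree_spanning_forest H G \<longleftrightarrow> (\<exists>e\<in>edges G. H = del_edge G e)"
proof
  note G = treeD[OF assms]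
  assume H: "two_tree_spanning_forest H G"
  then have sp: "spanning_subgraph H G" and c: "card (components H) = 2"
    by (auto simp: two_tree_spanning_forest_def)
  have "edges H \<noteq> edges G"
  proof
    assume "edges H = edges G"
    then have "H = G" using sp by (intro graph.equality) (auto simp: spanning_subgraph_def)
    obtain v where v: "v \<in> verts G" using G by blast
    then have "component_of G u = component_of G v" if "u \<in> verts G" for u
      using component_of_eq_iff[OF G(1)] tree_adj_rtrancl[OF assms] that by blast
    then have "components G = {component_of G v}" using v unfolding components_eq by blast
    then show False using c \<open>H = G\<close> by simp
  qed
  then obtain e where e: "e \<in> edges G" "e \<notin> edges H"
    using sp by (auto simp: spanning_subgraph_def)
  have "edges H = edges G - {e}"
    using spanning_subgraph_two_missing[OF assms sp e] c sp e
    unfolding spanning_subgraph_def by blast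
  then have "H = del_edge G e"
    using sp by (intro graph.equality) (auto simp: spanning_subgraph_def)
  then show "\<exists>e\<in>edges G. H = del_edge G e" using e by blast
next
  assume "\<exists>e\<in>edges G. H = del_edge G e"
  then obtain e where e: "e \<in> edges G" "H = del_edge G e" by blast
  then obtain a b where "e = {a, b}" using simple_graph_edgeE treeD(1)[OF assms] by metis
  then have "card (components H) = 2" using card_components_del_edge assms e by metis
  moreover have "spanning_subgraph H G" using e by (auto simp: spanning_subgraph_def)
  ultimately show "two_tree_spanning_forest H G"
    using forest_spanning_subgraph treeD(2)[OF assms]
    by (auto simp: two_tree_spanning_forest_def)
qed

section \<open>Forest counts as numbers of separating edges\<close>

text \<open>In a tree these are the edges of the path from \<open>i\<close> to \<open>j\<close>.
  Describing them by disconnection matches the deletion forests and makes the symmetry in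
  \<open>i\<close> and \<open>j\<close> immediate.\<close>

definition separators :: "'v graph \<Rightarrow> 'v \<Rightarrow> 'v \<Rightarrow> 'v set set" where
  "separators G i j = {e \<in> edges G. (i, j) \<notin> (adj (del_edge G e))\<^sup>*}"

lemma separators_sym: "separators G i j = separators G j i"
  by (auto simp: separators_def intro: adj_rtrancl_sym)

lemma forest_count_tree_eq_separators:
  assumes "tree G" "i \<in> verts G" "j \<in> verts G"
  shows "forest_count G i j = card (separators G i j)"
proof -
  have "{H. two_tree_spanning_forest H G \<and>
      (\<exists>A\<in>components H. \<exists>B\<in>components H. A \<noteq> B \<and> i \<in> A \<and> j \<in> B)} =
    del_edge G ` separators G i j"
    using assms in_different_components_iff[where i = i and j = j,
        OF simple_graph_del_edge[OF treeD(1)[OF assms(1)]]]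
    unfolding two_tree_spanning_forest_tree_iff[OF assms(1)] separators_def by fastforce
  \<comment> \<open>Separators are edges of \<open>G\<close>, so the deleted edge can be read off
    from the result.\<close>
  moreover have "inj_on (del_edge G) (separators G i j)"
  proof (rule inj_onI)
    fix e f
    assume ef: "e \<in> separators G i j" "f \<in> separators G i j" "del_edge G e = del_edge G f"
    then have "edges G - {e} = edges G - {f}" by (metis edges_del_edge)
    then show "e = f" using ef by (auto simp: separators_def)
  qed
  ultimately show ?thesis by (simp add: forest_count_def card_image)
qed

section \<open>Distances in trees\<close>

lemma graph_dist_le: "walk G u p v \<Longrightarrow> length p = Suc k \<Longrightarrow> graph_dist G u v \<le> k"
  unfolding graph_dist_def by (rule Least_le) blast

lemma graph_dist_walk:
  assumes "walk G u p v"
  obtains q where "walk G u q v" "length q = Suc (graph_dist G u v)"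
proof -
  obtain k where "length p = Suc k" using assms by (cases p) (auto simp: walk_def)
  then have "\<exists>p. walk G u p v \<and> length p = Suc (graph_dist G u v)"
    using LeastI[of "\<lambda>k. \<exists>p. walk G u p v \<and> length p = Suc k" k] assms
    unfolding graph_dist_def by blast
  then show thesis using that by blast
qed

lemma graph_dist_refl: "u \<in> verts G \<Longrightarrow> graph_dist G u u = 0"
  using graph_dist_le[OF walk_refl] by fastforce

text \<open>\<open>w\<close> is the last vertex but one of a shortest walk. Dropping
  \<open>v\<close> from that walk gives one inequality, appending \<open>v\<close> to a shortest
  walk to \<open>w\<close> the other.\<close>

lemma graph_dist_predecessor:
  assumes "simple_graph G" "reachable G u v" "u \<noteq> v"
  obtains w where "{w, v} \<in> edges G" "graph_dist G u v = Suc (graph_dist G u w)"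
proof -
  obtain p0 where "walk G u p0 v" using assms by (auto simp: reachable_def)
  then obtain p where p: "walk G u p v" "length p = Suc (graph_dist G u v)"
    using graph_dist_walk by metis
  obtain q x where q: "p = q @ [x]" using p(2) by (metis length_Suc_conv_rev)
  have ne: "q \<noteq> []" using q p assms by (auto simp: walk_def)
  note w = walk_snocD[OF p(1)[unfolded q] ne]
  have e: "{last q, v} \<in> edges G" using w by simp
  obtain k where k: "length q = Suc k" using ne by (cases q) auto
  have "graph_dist G u (last q) \<le> k" using graph_dist_le w k by metis
  moreover have "graph_dist G u v = Suc k" using p q k by simp
  moreover obtain r where r: "walk G u r (last q)" "length r = Suc (graph_dist G u (last q))"
    using graph_dist_walk[OF w(2)] by metis
  have "graph_dist G u v \<le> Suc (graph_dist G u (last q))"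
    by (rule graph_dist_le[OF walk_snoc[OF r(1) e]])
      (use r simple_graph_edgeD[OF assms(1) e] in auto)
  ultimately show thesis using that e by simp
qed

lemma tree_predecessor:
  assumes "tree G" "i \<in> verts G" "j \<in> verts G" "j \<noteq> i"
  obtains w where "w \<in> verts G" "{w, j} \<in> edges G" "graph_dist G i j = Suc (graph_dist G i w)"
proof -
  note G = treeD[OF assms(1)]
  have "reachable G i j" using G assms by (simp add: connected_graph_def)
  then show thesis
    using graph_dist_predecessor[OF G(1)] assms simple_graph_edgeD[OF G(1)] that by metis
qed

text \<open>Going back from \<open>w\<close> to \<open>i\<close> through predecessors only meets
  vertices closer to \<open>i\<close> than \<open>j\<close>, so no edge at \<open>j\<close> is
  used.\<close>

lemma tree_reach_avoiding:
  assumes "tree G" "i \<in> verts G" "w \<in> verts G" "graph_dist G i w < graph_dist G i j"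
  shows "(i, w) \<in> (adj (del_edge G {x, j}))\<^sup>*"
  using assms(3,4)
proof (induction "graph_dist G i w" arbitrary: w rule: less_induct)
  case less
  show ?case
  proof (cases "w = i")
    case False
    then obtain y where y: "y \<in> verts G" "{y, w} \<in> edges G"
      "graph_dist G i w = Suc (graph_dist G i y)"
      using tree_predecessor assms less.prems by metis
    then have "(i, y) \<in> (adj (del_edge G {x, j}))\<^sup>*" using less by simp
    moreover have "{y, w} \<noteq> {x, j}" using y less.prems by (auto simp: doubleton_eq_iff)
    then have "(y, w) \<in> adj (del_edge G {x, j})" using y by (simp add: adj_def)
    ultimately show ?thesis by simp
  qed simp
qed

text \<open>Induction on the distance: passing from the predecessor \<open>w\<close> to
  \<open>j\<close> adds exactly the separator \<open>{w, j}\<close>.\<close>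

lemma card_separators_tree:
  assumes "tree G" "i \<in> verts G" "j \<in> verts G"
  shows "card (separators G i j) = graph_dist G i j"
  using assms(3)
proof (induction "graph_dist G i j" arbitrary: j rule: less_induct)
  case less
  note G = treeD[OF assms(1)]
  show ?case
  proof (cases "j = i")
    case True
    then show ?thesis using assms by (simp add: separators_def graph_dist_refl)
  next
    case False
    then obtain w where w: "w \<in> verts G" "{w, j} \<in> edges G"
      "graph_dist G i j = Suc (graph_dist G i w)"
      using tree_predecessor assms less.prems by metis
    have r: "(i, w) \<in> (adj (del_edge G {w, j}))\<^sup>*"
      using tree_reach_avoiding assms w by (metis lessI)
    then have n1: "{w, j} \<notin> separators G i w" by (simp add: separators_def)
    have "(i, j) \<notin> (adj (del_edge G {w, j}))\<^sup>*"
      using forest_bridge[OF G(2) w(2)] r adj_rtrancl_sym rtrancl_trans by metis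
    then have n2: "{w, j} \<in> separators G i j" using w by (simp add: separators_def)
    \<comment> \<open>After the deletion of any other edge, \<open>w\<close> and \<open>j\<close>
      are still adjacent.\<close>
    have "e \<in> separators G i j \<longleftrightarrow> e \<in> separators G i w" if "e \<noteq> {w, j}" for e
    proof -
      have "(w, j) \<in> adj (del_edge G e)" "(j, w) \<in> adj (del_edge G e)"
        using w that by (auto simp: adj_def insert_commute)
      then show ?thesis by (auto simp: separators_def intro: rtrancl_into_rtrancl)
    qed
    then have "separators G i j = insert {w, j} (separators G i w)"
      using n2 by (intro set_eqI) (metis insert_iff)
    moreover have "finite (separators G i w)"
      using simple_graph_finite_edges[OF G(1)] by (simp add: separators_def)
    moreover have "card (separators G i w) = graph_dist G i w"
      using less.hyps[of w] w by linarith
    ultimately show ?thesis using w(3) n1 by simp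
  qed
qed

lemma forest_count_tree:
  assumes "tree G" "i \<in> verts G" "j \<in> verts G"
  shows "forest_count G i j = graph_dist G i j"
  using assms by (simp add: forest_count_tree_eq_separators card_separators_tree)

text \<open>Inherited from the symmetry of \<open>separators\<close>, without reversing
  walks.\<close>

lemma graph_dist_tree_sym:
  assumes "tree G" "i \<in> verts G" "j \<in> verts G"
  shows "graph_dist G i j = graph_dist G j i"
  using assms by (metis card_separators_tree separators_sym)

section \<open>Rooting the tree and the entries of \<open>D d\<close>\<close>

text \<open>\<open>par\<close> is the parent map of the tree rooted at \<open>i\<close>. Two
  vertices sharing a parent edge would be parents of each other, against the distances. The parent
  edges connect every vertex to the root, hence exhaust the edges.\<close>

lemma tree_predecessor_bij:
  assumes "tree G" "i \<in> verts G"
  obtains par where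
    "bij_betw (\<lambda>j. {par j, j}) (verts G - {i}) (edges G)"
    "\<And>j. j \<in> verts G - {i} \<Longrightarrow> graph_dist G i j = Suc (graph_dist G i (par j))"
proof -
  note G = treeD[OF assms(1)]
  have "\<exists>w. w \<in> verts G \<and> {w, j} \<in> edges G \<and> graph_dist G i j = Suc (graph_dist G i w)"
    if "j \<in> verts G - {i}" for j
    using tree_predecessor[OF assms] that by (metis DiffE insertCI)
  then obtain par where par: "\<And>j. j \<in> verts G - {i} \<Longrightarrow>
      par j \<in> verts G \<and> {par j, j} \<in> edges G \<and> graph_dist G i j = Suc (graph_dist G i (par j))"
    by metis
  let ?E = "(\<lambda>j. {par j, j}) ` (verts G - {i})"
  let ?R = "{(x, y). {x, y} \<in> ?E}"
  have "inj_on (\<lambda>j. {par j, j}) (verts G - {i})"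
  proof (rule inj_onI, rule ccontr)
    fix j k
    assume jk: "j \<in> verts G - {i}" "k \<in> verts G - {i}" "{par j, j} = {par k, k}" "j \<noteq> k"
    then have "par j = k" "par k = j" by (auto simp: doubleton_eq_iff)
    then show False using par[OF jk(1)] par[OF jk(2)] by simp
  qed
  moreover have "?E = edges G"
  proof (rule tree_spanning_connected_edges_eq[OF assms(1)])
    show "?E \<subseteq> edges G" using par by auto
    have root: "(i, j) \<in> ?R\<^sup>*" if "j \<in> verts G" for j
      using that
    proof (induction "graph_dist G i j" arbitrary: j rule: less_induct)
      case less
      show ?case
      proof (cases "j = i")
        case False
        then have j: "j \<in> verts G - {i}" using less by simp
        then have "(i, par j) \<in> ?R\<^sup>*" using less par by simp
        moreover have "(par j, j) \<in> ?R" using j by auto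
        ultimately show ?thesis by (rule rtrancl_into_rtrancl)
      qed simp
    qed
    have "sym ?R" by (auto simp: sym_def insert_commute)
    then have "sym (?R\<^sup>*)" by (rule sym_rtrancl)
    then show "(u, v) \<in> ?R\<^sup>*" if "u \<in> verts G" "v \<in> verts G" for u v
      using root[OF that(1)] root[OF that(2)] by (meson rtrancl_trans symD)
  qed
  ultimately show thesis using that[of par] par by (simp add: bij_betw_def)
qed

lemma num_edges_tree:
  assumes "tree G"
  shows "num_edges G = card (verts G) - 1"
proof -
  note G = treeD[OF assms]
  obtain i where i: "i \<in> verts G" using G by blast
  obtain par where "bij_betw (\<lambda>j. {par j, j}) (verts G - {i}) (edges G)"
    using tree_predecessor_bij[OF assms i] by metis
  then show ?thesis
    using bij_betw_same_card i simple_graph_finite_verts[OF G(1)]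
    by (fastforce simp: num_edges_def)
qed

text \<open>Double counting of incidences, weighted by \<open>g\<close>. Constant weight 1 gives the
  handshake lemma, the distance to \<open>i\<close> gives an entry of \<open>D d\<close>.\<close>

lemma sum_degree_times:
  fixes g :: "'v \<Rightarrow> real"
  assumes "simple_graph G"
  shows "(\<Sum>v\<in>verts G. real (degree G v) * g v) = (\<Sum>e\<in>edges G. \<Sum>v\<in>e. g v)"
proof -
  have "(\<Sum>v\<in>verts G. real (degree G v) * g v) = (\<Sum>v\<in>verts G. \<Sum>e | e \<in> edges G \<and> v \<in> e. g v)"
    by (simp add: degree_def)
  also have "\<dots> = (\<Sum>e\<in>edges G. \<Sum>v | v \<in> verts G \<and> v \<in> e. g v)"
    using assms by (intro sum.swap_restrict simple_graph_finite_verts simple_graph_finite_edges)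
  also have "\<dots> = (\<Sum>e\<in>edges G. \<Sum>v\<in>e. g v)"
    using assms by (intro sum.cong refl) (auto simp: simple_graph_def)
  finally show ?thesis .
qed

lemma sum_degree:
  assumes "simple_graph G"
  shows "(\<Sum>v\<in>verts G. real (degree G v)) = 2 * real (num_edges G)"
proof -
  have "(\<Sum>e\<in>edges G. \<Sum>v\<in>e. 1 :: real) = (\<Sum>e\<in>edges G. 2)"
    using assms by (intro sum.cong refl) (simp add: simple_graph_def)
  then show ?thesis using sum_degree_times[OF assms, of "\<lambda>_. 1"] by (simp add: num_edges_def)
qed

lemma sum_degree_dist_tree:
  assumes "tree G" "i \<in> verts G"
  shows "(\<Sum>j\<in>verts G. real (degree G j) * real (graph_dist G i j)) =
    2 * (\<Sum>j\<in>verts G. real (graph_dist G i j)) - (real (card (verts G)) - 1)"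
proof -
  note G = treeD[OF assms(1)]
  note fin = simple_graph_finite_verts[OF G(1)]
  let ?d = "\<lambda>j. real (graph_dist G i j)"
  obtain par where par: "bij_betw (\<lambda>j. {par j, j}) (verts G - {i}) (edges G)"
    "\<And>j. j \<in> verts G - {i} \<Longrightarrow> graph_dist G i j = Suc (graph_dist G i (par j))"
    using tree_predecessor_bij[OF assms] by metis
  have "(\<Sum>j\<in>verts G. real (degree G j) * ?d j) = (\<Sum>e\<in>edges G. \<Sum>v\<in>e. ?d v)"
    by (rule sum_degree_times[OF G(1)])
  also have "\<dots> = (\<Sum>j\<in>verts G - {i}. \<Sum>v\<in>{par j, j}. ?d v)"
    by (rule sum.reindex_bij_betw[OF par(1), symmetric])
  also have "\<dots> = (\<Sum>j\<in>verts G - {i}. 2 * ?d j - 1)"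
  proof (rule sum.cong[OF refl])
    fix j assume j: "j \<in> verts G - {i}"
    then have "par j \<noteq> j" using par(2)[OF j] by auto
    then show "(\<Sum>v\<in>{par j, j}. ?d v) = 2 * ?d j - 1" using par(2)[OF j] by simp
  qed
  also have "\<dots> = 2 * (\<Sum>j\<in>verts G - {i}. ?d j) - real (card (verts G - {i}))"
    by (simp add: sum_subtractf sum_distrib_left)
  \<comment> \<open>The root can be put back, being at distance 0 from itself.\<close>
  also have "(\<Sum>j\<in>verts G - {i}. ?d j) = (\<Sum>j\<in>verts G. ?d j)"
    using sum.remove[OF fin assms(2), of ?d] assms by (simp add: graph_dist_refl)
  also have "real (card (verts G - {i})) = real (card (verts G)) - 1"
    using card_Suc_Diff1[OF fin assms(2)] by linarith
  finally show ?thesis .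
qed

section \<open>Kemeny's constant in terms of the Wiener index\<close>

text \<open>The formula for \<open>D d\<close> is used twice: for \<open>D d\<close> inside the
  quadratic form, then, by symmetry of \<open>D\<close>, for the remaining product of
  \<open>d\<close> with \<open>D 1\<close>. For \<open>n = 1\<close> both sides are divisions by
  zero, hence 0.\<close>

lemma kemeny_tree:
  assumes "tree G"
  defines "n \<equiv> real (card (verts G))"
  shows "kemeny G = (8 * wiener_index G - 2 * (n - 1) * (2 * n - 1)) / (4 * (n - 1))"
proof -
  note G = treeD[OF assms(1)]
  let ?V = "verts G"
  let ?d = "\<lambda>j. real (degree G j)" and ?D = "\<lambda>i j. real (graph_dist G i j)"
  \<comment> \<open>Positivity lets the truncated subtraction in the edge count agree with the real
    \<open>n - 1\<close>.\<close>
  have "card ?V > 0" using G simple_graph_finite_verts by (simp add: card_gt_0_iff)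
  then have m: "real (num_edges G) = n - 1" by (simp add: num_edges_tree[OF assms(1)] n_def)
  have W: "(\<Sum>i\<in>?V. \<Sum>j\<in>?V. ?D i j) = 2 * wiener_index G" by (simp add: wiener_index_def)
  have "(\<Sum>i\<in>?V. ?d i * (\<Sum>j\<in>?V. ?D i j)) = (\<Sum>i\<in>?V. \<Sum>j\<in>?V. ?d i * ?D j i)"
    using graph_dist_tree_sym[OF assms(1)] by (simp add: sum_distrib_left)
  also have "\<dots> = (\<Sum>j\<in>?V. \<Sum>i\<in>?V. ?d i * ?D j i)" by (rule sum.swap)
  also have "\<dots> = (\<Sum>j\<in>?V. 2 * (\<Sum>i\<in>?V. ?D j i) - (n - 1))"
    by (simp add: sum_degree_dist_tree[OF assms(1)] n_def)
  also have "\<dots> = 4 * wiener_index G - n * (n - 1)"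
    by (simp add: sum_subtractf sum_distrib_left[symmetric] W n_def)
  finally have dD1: "(\<Sum>i\<in>?V. ?d i * (\<Sum>j\<in>?V. ?D i j)) = 4 * wiener_index G - n * (n - 1)" .
  have "(\<Sum>i\<in>?V. \<Sum>j\<in>?V. ?d i * real (forest_count G i j) * ?d j) =
      (\<Sum>i\<in>?V. ?d i * (\<Sum>j\<in>?V. ?d j * ?D i j))"
    by (simp add: forest_count_tree[OF assms(1)] sum_distrib_left mult_ac)
  also have "\<dots> = (\<Sum>i\<in>?V. 2 * (?d i * (\<Sum>j\<in>?V. ?D i j)) - ?d i * (n - 1))"
    by (simp add: sum_degree_dist_tree[OF assms(1)] n_def right_diff_distrib mult_ac)
  also have "\<dots> = 2 * (4 * wiener_index G - n * (n - 1)) - 2 * (n - 1) * (n - 1)"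
    unfolding sum_subtractf sum_distrib_left[symmetric] sum_distrib_right[symmetric]
      dD1 sum_degree[OF G(1)] m ..
  also have "\<dots> = 8 * wiener_index G - 2 * (n - 1) * (2 * n - 1)"
    by (simp add: algebra_simps)
  finally show ?thesis
    by (simp add: kemeny_def m num_spanning_trees_tree[OF assms(1)])
qed

theorem theorem2p2:
  fixes n :: nat and T1 T2 :: "nat graph"
  assumes "n \<ge> 2"
    and "verts T1 = {1..n}" and "verts T2 = {1..n}"
    and "tree T1" and "tree T2"
    and "\<not> isomorphic T1 T2"
  shows "co_Kemeny_mates T1 T2 \<longleftrightarrow> wiener_index T1 = wiener_index T2"
proof -
  \<comment> \<open>Both trees have the same \<open>n\<close>, and \<open>n \<ge> 2\<close> makes
    the common denominator \<open>4 * (n - 1)\<close> nonzero, so it cancels.\<close>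
  have "kemeny T1 = kemeny T2 \<longleftrightarrow> wiener_index T1 = wiener_index T2"
    using assms by (simp add: kemeny_tree divide_cancel_right)
  then show ?thesis using assms treeD(4) by (auto simp: co_Kemeny_mates_def)
qed

end
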